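(* Let $\mathcal{X}=(X,X_0,d_1,d_2)$ be an essentially smooth double-distance context, where $X_0$ is a connected manifold and $(X_0,d_1)$ is a metric space. Let $(G,p)$ be a minimally infinitesimally rigid framework for $\mathcal{X}$, with joints in $X_0$, and let $G=(V,E)$. Then $$|E|=\dim(X_0)\,|V|-\dim\big(\mathcal{F}((K(V),p))\big),$$ where $\mathcal{F}((K(V),p))$ is the infinitesimal flex space of the framework $(K(V),p)$ for the complete bi-coloured multigraph $K(V)$ on $V$.
   Context: A separation distance on a set $X$ is a continuous symmetric function $d:X\times X\to[0,\infty)$ (no triangle inequality is required, and $d(x,x)$ may be nonzero). An essentially smooth double-distance context $(X,X_0,d_1,d_2)$ consists of a topological space $X$ with separation distances $d_1,d_2$ and a dense open subset $X_0\subseteq X$ (possibly equal to $X$) which is a compatible smooth manifold, such that $d_1,d_2$ are differentiable functions on $X_0\times X_0$ which determine the topology of $X_0$. A structure graph $G=(V,E)$ is a finite multigraph whose edges (possibly including loops) are each given one of two colours $1,2$, with no two parallel edges of the same colour and no two loops of the same colour at a vertex. $K(V)$ is the complete bi-coloured multigraph: two edges of distinct colours between each pair of distinct vertices and two loops of distinct colours at each vertex. A framework $(G,p)$ with joints in $X_0$ is such a graph with a placement $p:V\to X_0$, with $p(v)\neq p(w)$ whenever $v\ne w$ are adjacent. The rigidity map $f_G:\prod_{v\in V}X_0\to\mathbb{R}^{E}$ sends $(x_v)_{v\in V}$ to the tuple with entry $d_i(x_v,x_w)$ for each edge $vw$ of colour $i$. An infinitesimal flex of $(G,p)$ is a velocity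 vector $u\in\bigoplus_{v\in V}T_{p(v)}X_0$ which to first order does not change any edge separation, that is, a vector in the kernel of the derivative $Df_G(p)$. $(G,p)$ is infinitesimally rigid if every infinitesimal flex of $(G,p)$ is an infinitesimal flex of $(K(V),p)$. It is minimally infinitesimally rigid if it is infinitesimally rigid and, for every edge $e$, $(G-e,p)$ has an infinitesimal flex that is not an infinitesimal flex of $(K(V),p)$. *)

theory Defs
  imports
    "HOL-Analysis.Analysis"
    "HOL-Library.Uprod"
    "HOL-Library.Function_Algebras"
begin

section \<open>Pointwise vector space structure on functions\<close>

text \<open>Together with the additive structure from Function_Algebras this makes \<^const>\<open>dim\<close>
  applicable to spaces of velocity vectors, which are functions below.\<close>

instantiation "fun" :: (type, real_vector) real_vector
begin

definition scaleR_fun :: "real \<Rightarrow> ('a \<Rightarrow> 'b) \<Rightarrow> 'a \<Rightarrow> 'b" where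
  "scaleR_fun r f = (\<lambda>x. r *\<^sub>R f x)"

instance
  by standard (auto simp: scaleR_fun_def plus_fun_def fun_eq_iff algebra_simps)

end


section \<open>Smooth manifolds\<close>

text \<open>Manifolds are modelled on a linear subspace \<open>E\<close> of a Euclidean space, i.e. on
  \<open>\<real>\<^sup>n\<close> with \<open>n = dim E\<close>; as Euclidean space types have positive dimension, taking a subspace
  is what makes \<open>n = 0\<close> available. All derivatives are taken within subsets that are relatively
  open in \<open>E\<close> (or in a power of \<open>E\<close>), hence they are determined on \<open>E\<close>, and are only
  evaluated there.\<close>

primrec times_differentiable_on ::
    "nat \<Rightarrow> 'e::euclidean_space set \<Rightarrow> 'e set \<Rightarrow> ('e \<Rightarrow> 'b::real_normed_vector) \<Rightarrow> bool" where
  "times_differentiable_on 0 E W f \<longleftrightarrow> continuous_on W f"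
| "times_differentiable_on (Suc k) E W f \<longleftrightarrow>
     f differentiable_on W \<and>
     (\<forall>v\<in>E. times_differentiable_on k E W (\<lambda>x. frechet_derivative f (at x within W) v))"

definition smooth_on ::
    "'e::euclidean_space set \<Rightarrow> 'e set \<Rightarrow> ('e \<Rightarrow> 'b::real_normed_vector) \<Rightarrow> bool" where
  "smooth_on E W f \<longleftrightarrow> (\<forall>k. times_differentiable_on k E W f)"

text \<open>A chart is a pair \<open>(U, \<phi>)\<close>; the values of \<open>\<phi>\<close> outside \<open>U\<close> are irrelevant.\<close>

type_synonym ('a, 'e) chart = "'a set \<times> ('a \<Rightarrow> 'e)"

definition chart_image :: "('a, 'e) chart \<Rightarrow> 'e set" where
  "chart_image \<kappa> = snd \<kappa> ` fst \<kappa>"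

definition chart_inv :: "('a, 'e) chart \<Rightarrow> 'e \<Rightarrow> 'a" where
  "chart_inv \<kappa> = inv_into (fst \<kappa>) (snd \<kappa>)"

definition overlap :: "('a, 'e) chart \<Rightarrow> ('a, 'e) chart \<Rightarrow> 'e set" where
  "overlap \<kappa> \<mu> = snd \<kappa> ` (fst \<kappa> \<inter> fst \<mu>)"

definition transition :: "('a, 'e) chart \<Rightarrow> ('a, 'e) chart \<Rightarrow> 'e \<Rightarrow> 'e" where
  "transition \<kappa> \<mu> = snd \<mu> \<circ> chart_inv \<kappa>"

text \<open>The manifold topology on \<open>M\<close> is the one inherited from the ambient space.\<close>

definition smooth_manifold ::
    "'a::topological_space set \<Rightarrow> 'e::euclidean_space set \<Rightarrow> ('a, 'e) chart set \<Rightarrow> bool" where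
  "smooth_manifold M E A \<longleftrightarrow>
     subspace E \<and>
     Hausdorff_space (top_of_set M) \<and>
     second_countable (top_of_set M) \<and>
     (\<Union>\<kappa>\<in>A. fst \<kappa>) = M \<and>
     (\<forall>\<kappa>\<in>A. openin (top_of_set M) (fst \<kappa>) \<and>
             openin (top_of_set E) (chart_image \<kappa>) \<and>
             homeomorphism (fst \<kappa>) (chart_image \<kappa>) (snd \<kappa>) (chart_inv \<kappa>)) \<and>
     (\<forall>\<kappa>\<in>A. \<forall>\<mu>\<in>A. smooth_on E (overlap \<kappa> \<mu>) (transition \<kappa> \<mu>))"

definition charts_at :: "('a, 'e) chart set \<Rightarrow> 'a \<Rightarrow> ('a, 'e) chart set" where
  "charts_at A x = {\<kappa> \<in> A. x \<in> fst \<kappa>}"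

text \<open>A tangent vector at \<open>x\<close> is the family of its coordinate representatives in the charts of
  the atlas around \<open>x\<close>, related to each other by the derivatives of the transition maps. (It is
  the graph of an equivalence class in the usual description by pairs of a chart and a vector.)
  The value 0 at the other charts is a convention that makes the representation unique.\<close>

definition tangent_space ::
    "'e::euclidean_space set \<Rightarrow> ('a, 'e) chart set \<Rightarrow> 'a \<Rightarrow> (('a, 'e) chart \<Rightarrow> 'e) set" where
  "tangent_space E A x =
     {\<xi>. (\<forall>\<kappa>. \<kappa> \<notin> charts_at A x \<longrightarrow> \<xi> \<kappa> = 0) \<and>
         (\<forall>\<kappa>\<in>charts_at A x. \<xi> \<kappa> \<in> E) \<and>
         (\<forall>\<kappa>\<in>charts_at A x. \<forall>\<mu>\<in>charts_at A x.
            \<xi> \<mu> = frechet_derivative (transition \<kappa> \<mu>) (at (snd \<kappa> x) within overlap \<kappa> \<mu>) (\<xi> \<kappa>))}"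

text \<open>For a finite type \<open>'v\<close>, the power of the manifold has the product charts
  \<open>(x\<^sub>v) \<mapsto> (\<phi>\<^sub>v x\<^sub>v)\<close>, one for each family of charts; its tangent spaces are direct sums.\<close>

definition power_chart_image :: "('v::finite \<Rightarrow> ('a, 'e) chart) \<Rightarrow> ('e ^ 'v) set" where
  "power_chart_image c = {a. \<forall>v. a $ v \<in> chart_image (c v)}"

definition power_chart_inv :: "('v::finite \<Rightarrow> ('a, 'e) chart) \<Rightarrow> 'e ^ 'v \<Rightarrow> 'v \<Rightarrow> 'a" where
  "power_chart_inv c a = (\<lambda>v. chart_inv (c v) (a $ v))"

definition power_tangent_space ::
    "'e::euclidean_space set \<Rightarrow> ('a, 'e) chart set \<Rightarrow> ('v \<Rightarrow> 'a) \<Rightarrow>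
     ('v \<Rightarrow> ('a, 'e) chart \<Rightarrow> 'e) set" where
  "power_tangent_space E A p = {u. \<forall>v. u v \<in> tangent_space E A (p v)}"

text \<open>\<open>f\<close> is differentiable at \<open>p\<close> and \<open>Df(p) u = w\<close>.\<close>

definition has_differential_value ::
    "('a, 'e::euclidean_space) chart set \<Rightarrow> (('v::finite \<Rightarrow> 'a) \<Rightarrow> 'b::real_normed_vector) \<Rightarrow>
     ('v \<Rightarrow> 'a) \<Rightarrow> ('v \<Rightarrow> ('a, 'e) chart \<Rightarrow> 'e) \<Rightarrow> 'b \<Rightarrow> bool" where
  "has_differential_value A f p u w \<longleftrightarrow>
     (\<forall>c. (\<forall>v. c v \<in> charts_at A (p v)) \<longrightarrow>
        (\<exists>D. ((f \<circ> power_chart_inv c) has_derivative D)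
               (at (\<chi> v. snd (c v) (p v)) within power_chart_image c) \<and>
             D (\<chi> v. u v (c v)) = w))"


section \<open>Double-distance contexts\<close>

definition separation_distance :: "('a::topological_space \<Rightarrow> 'a \<Rightarrow> real) \<Rightarrow> bool" where
  "separation_distance d \<longleftrightarrow>
     continuous_on UNIV (\<lambda>(x, y). d x y) \<and> (\<forall>x y. d x y = d y x) \<and> (\<forall>x y. 0 \<le> d x y)"

definition sep_in_charts ::
    "('a \<Rightarrow> 'a \<Rightarrow> real) \<Rightarrow> ('a, 'e) chart \<Rightarrow> ('a, 'e) chart \<Rightarrow> 'e \<times> 'e \<Rightarrow> real" where
  "sep_in_charts d \<kappa> \<mu> = (\<lambda>(a, b). d (chart_inv \<kappa> a) (chart_inv \<mu> b))"

definition sep_differentiable_at ::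
    "('a, 'e::euclidean_space) chart set \<Rightarrow> ('a \<Rightarrow> 'a \<Rightarrow> real) \<Rightarrow> 'a \<Rightarrow> 'a \<Rightarrow> bool" where
  "sep_differentiable_at A d x y \<longleftrightarrow>
     (\<forall>\<kappa>\<in>charts_at A x. \<forall>\<mu>\<in>charts_at A y.
        sep_in_charts d \<kappa> \<mu> differentiable
          (at (snd \<kappa> x, snd \<mu> y) within chart_image \<kappa> \<times> chart_image \<mu>))"

definition self_sep_differentiable_at ::
    "('a, 'e::euclidean_space) chart set \<Rightarrow> ('a \<Rightarrow> 'a \<Rightarrow> real) \<Rightarrow> 'a \<Rightarrow> bool" where
  "self_sep_differentiable_at A d x \<longleftrightarrow>
     (\<forall>\<kappa>\<in>charts_at A x.
        (\<lambda>a. d (chart_inv \<kappa> a) (chart_inv \<kappa> a)) differentiable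
          (at (snd \<kappa> x) within chart_image \<kappa>))"

text \<open>Differentiability of a separation distance is required where edges evaluate it: at pairs of
  distinct points, for the edges between distinct vertices, and along the diagonal, for the loops.
  Differentiability at the diagonal points as a function of two variables is deliberately not
  required: it fails for the Euclidean distance, and no metric on a connected manifold of
  positive dimension has it, since its value along a smooth curve from \<open>x\<close>, measured
  from \<open>x\<close>, would have derivative 0. Differentiability on all of \<open>M \<times> M\<close> is a special
  case, see \<open>differentiable_separationI\<close>.\<close>

definition differentiable_separation ::
    "'a set \<Rightarrow> ('a, 'e::euclidean_space) chart set \<Rightarrow> ('a \<Rightarrow> 'a \<Rightarrow> real) \<Rightarrow> bool" where
  "differentiable_separation M A d \<longleftrightarrow>
     (\<forall>x\<in>M. \<forall>y\<in>M. x \<noteq> y \<longrightarrow> sep_differentiable_at A d x y) \<and>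
     (\<forall>x\<in>M. self_sep_differentiable_at A d x)"

lemma differentiable_separationI:
  assumes "\<And>x y. x \<in> M \<Longrightarrow> y \<in> M \<Longrightarrow> sep_differentiable_at A d x y"
  shows "differentiable_separation M A d"
proof -
  have "self_sep_differentiable_at A d x" if "x \<in> M" for x
    unfolding self_sep_differentiable_at_def
  proof
    fix \<kappa> assume "\<kappa> \<in> charts_at A x"
    then have "sep_in_charts d \<kappa> \<kappa> differentiable
        (at (snd \<kappa> x, snd \<kappa> x) within chart_image \<kappa> \<times> chart_image \<kappa>)"
      using assms[OF that that] by (auto simp: sep_differentiable_at_def)
    then have "sep_in_charts d \<kappa> \<kappa> differentiable
        (at (snd \<kappa> x, snd \<kappa> x) within (\<lambda>a. (a, a)) ` chart_image \<kappa>)"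
      by (rule differentiable_within_subset) auto
    moreover have "(\<lambda>a. (a, a)) differentiable (at (snd \<kappa> x) within chart_image \<kappa>)"
      unfolding differentiable_def by (auto intro!: derivative_eq_intros exI)
    ultimately have "(sep_in_charts d \<kappa> \<kappa> \<circ> (\<lambda>a. (a, a))) differentiable
        (at (snd \<kappa> x) within chart_image \<kappa>)"
      by (intro differentiable_chain_within)
    then show "(\<lambda>a. d (chart_inv \<kappa> a) (chart_inv \<kappa> a)) differentiable
        (at (snd \<kappa> x) within chart_image \<kappa>)"
      by (simp add: sep_in_charts_def o_def)
  qed
  then show ?thesis
    using assms by (simp add: differentiable_separation_def)
qed

text \<open>The topology of \<open>M\<close> is the coarsest one for which the functions \<open>d\<^sub>i x\<close>
  (\<open>x \<in> M\<close>, \<open>i = 1, 2\<close>) are continuous. For a single metric this is the metric topology;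
  for a general separation distance balls need not contain their centres.\<close>

definition determine_topology ::
    "'a::topological_space set \<Rightarrow> ('a \<Rightarrow> 'a \<Rightarrow> real) \<Rightarrow> ('a \<Rightarrow> 'a \<Rightarrow> real) \<Rightarrow> bool" where
  "determine_topology M d\<^sub>1 d\<^sub>2 \<longleftrightarrow>
     top_of_set M =
       topology_generated_by {{y \<in> M. d x y \<in> W} |d x W. d \<in> {d\<^sub>1, d\<^sub>2} \<and> x \<in> M \<and> open W}"

text \<open>The space \<open>X\<close> is the type \<open>'a\<close>, and \<open>A\<close> is an atlas of the smooth structure of \<open>X\<^sub>0\<close>.\<close>

definition ess_smooth_double_distance_context ::
    "'a::topological_space set \<Rightarrow> 'e::euclidean_space set \<Rightarrow> ('a, 'e) chart set \<Rightarrow>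
     ('a \<Rightarrow> 'a \<Rightarrow> real) \<Rightarrow> ('a \<Rightarrow> 'a \<Rightarrow> real) \<Rightarrow> bool" where
  "ess_smooth_double_distance_context X\<^sub>0 E A d\<^sub>1 d\<^sub>2 \<longleftrightarrow>
     open X\<^sub>0 \<and> closure X\<^sub>0 = UNIV \<and>
     smooth_manifold X\<^sub>0 E A \<and>
     separation_distance d\<^sub>1 \<and> separation_distance d\<^sub>2 \<and>
     differentiable_separation X\<^sub>0 A d\<^sub>1 \<and> differentiable_separation X\<^sub>0 A d\<^sub>2 \<and>
     determine_topology X\<^sub>0 d\<^sub>1 d\<^sub>2"


section \<open>Structure graphs, frameworks and infinitesimal rigidity\<close>

datatype colour = Colour1 | Colour2

instance colour :: finite
proof
  have "(UNIV :: colour set) = {Colour1, Colour2}"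
    using colour.exhaust by auto
  then show "finite (UNIV :: colour set)"
    by (metis finite.emptyI finite.insertI)
qed

instance uprod :: (finite) finite
proof
  have "(UNIV :: 'a uprod set) = range (\<lambda>(x, y). Upair x y)"
    by (auto simp: image_iff) (metis uprod_exhaust)
  then show "finite (UNIV :: 'a uprod set)"
    by (metis finite finite_imageI)
qed

text \<open>The vertex set is the finite type \<open>'v\<close>. An edge is an unordered pair of vertices, possibly
  equal (a loop), with a colour; a structure graph on \<open>'v\<close> is then just a set of edges.\<close>

type_synonym 'v edge = "'v uprod \<times> colour"

definition complete_edges :: "'v edge set" where
  "complete_edges = UNIV"

definition framework :: "'a set \<Rightarrow> 'v edge set \<Rightarrow> ('v \<Rightarrow> 'a) \<Rightarrow> bool" where
  "framework X\<^sub>0 G p \<longleftrightarrow>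
     (\<forall>v. p v \<in> X\<^sub>0) \<and> (\<forall>v w i. (Upair v w, i) \<in> G \<and> v \<noteq> w \<longrightarrow> p v \<noteq> p w)"

fun colour_sep ::
    "('a \<Rightarrow> 'a \<Rightarrow> real) \<Rightarrow> ('a \<Rightarrow> 'a \<Rightarrow> real) \<Rightarrow> colour \<Rightarrow> 'a \<Rightarrow> 'a \<Rightarrow> real" where
  "colour_sep d\<^sub>1 d\<^sub>2 Colour1 = d\<^sub>1"
| "colour_sep d\<^sub>1 d\<^sub>2 Colour2 = d\<^sub>2"

text \<open>Well defined by symmetry of the separation distances, see \<open>edge_sep_Upair\<close>.\<close>

definition edge_sep ::
    "('a \<Rightarrow> 'a \<Rightarrow> real) \<Rightarrow> ('a \<Rightarrow> 'a \<Rightarrow> real) \<Rightarrow> 'v edge \<Rightarrow> ('v \<Rightarrow> 'a) \<Rightarrow> real" where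
  "edge_sep d\<^sub>1 d\<^sub>2 e x =
     (THE r. \<exists>v w. fst e = Upair v w \<and> r = colour_sep d\<^sub>1 d\<^sub>2 (snd e) (x v) (x w))"

lemma edge_sep_Upair:
  assumes "separation_distance d\<^sub>1" "separation_distance d\<^sub>2"
  shows "edge_sep d\<^sub>1 d\<^sub>2 (Upair v w, i) x = colour_sep d\<^sub>1 d\<^sub>2 i (x v) (x w)"
proof -
  have "colour_sep d\<^sub>1 d\<^sub>2 i a b = colour_sep d\<^sub>1 d\<^sub>2 i b a" for a b
    using assms by (cases i) (auto simp: separation_distance_def)
  then show ?thesis
    unfolding edge_sep_def by (intro the_equality) auto
qed

text \<open>The target \<open>\<real>\<^sup>G\<close> is the coordinate subspace of \<open>\<real>\<^sup>K\<close>, \<open>K\<close> the set of all edges, in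
  which the coordinates outside \<open>G\<close> vanish.\<close>

definition rigidity_map ::
    "('a \<Rightarrow> 'a \<Rightarrow> real) \<Rightarrow> ('a \<Rightarrow> 'a \<Rightarrow> real) \<Rightarrow> 'v::finite edge set \<Rightarrow>
     ('v \<Rightarrow> 'a) \<Rightarrow> real ^ 'v edge" where
  "rigidity_map d\<^sub>1 d\<^sub>2 G x = (\<chi> e. if e \<in> G then edge_sep d\<^sub>1 d\<^sub>2 e x else 0)"

text \<open>The kernel of the derivative of the rigidity map at \<open>p\<close>. It is the empty set if the rigidity
  map is not differentiable at \<open>p\<close>, which for frameworks in an essentially smooth context does
  not happen; it may happen for the complete graph if \<open>p\<close> is not injective, and then
  \<open>(G, p)\<close> does not count as infinitesimally rigid.\<close>

definition inf_flex_space ::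
    "'e::euclidean_space set \<Rightarrow> ('a, 'e) chart set \<Rightarrow> ('a \<Rightarrow> 'a \<Rightarrow> real) \<Rightarrow> ('a \<Rightarrow> 'a \<Rightarrow> real) \<Rightarrow>
     'v::finite edge set \<Rightarrow> ('v \<Rightarrow> 'a) \<Rightarrow> ('v \<Rightarrow> ('a, 'e) chart \<Rightarrow> 'e) set" where
  "inf_flex_space E A d\<^sub>1 d\<^sub>2 G p =
     {u \<in> power_tangent_space E A p. has_differential_value A (rigidity_map d\<^sub>1 d\<^sub>2 G) p u 0}"

definition inf_rigid ::
    "'e::euclidean_space set \<Rightarrow> ('a, 'e) chart set \<Rightarrow> ('a \<Rightarrow> 'a \<Rightarrow> real) \<Rightarrow> ('a \<Rightarrow> 'a \<Rightarrow> real) \<Rightarrow>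
     'v::finite edge set \<Rightarrow> ('v \<Rightarrow> 'a) \<Rightarrow> bool" where
  "inf_rigid E A d\<^sub>1 d\<^sub>2 G p \<longleftrightarrow>
     (\<forall>u \<in> inf_flex_space E A d\<^sub>1 d\<^sub>2 G p. u \<in> inf_flex_space E A d\<^sub>1 d\<^sub>2 complete_edges p)"

definition min_inf_rigid ::
    "'e::euclidean_space set \<Rightarrow> ('a, 'e) chart set \<Rightarrow> ('a \<Rightarrow> 'a \<Rightarrow> real) \<Rightarrow> ('a \<Rightarrow> 'a \<Rightarrow> real) \<Rightarrow>
     'v::finite edge set \<Rightarrow> ('v \<Rightarrow> 'a) \<Rightarrow> bool" where
  "min_inf_rigid E A d\<^sub>1 d\<^sub>2 G p \<longleftrightarrow>
     inf_rigid E A d\<^sub>1 d\<^sub>2 G p \<and>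
     (\<forall>e\<in>G. \<exists>u \<in> inf_flex_space E A d\<^sub>1 d\<^sub>2 (G - {e}) p.
        u \<notin> inf_flex_space E A d\<^sub>1 d\<^sub>2 complete_edges p)"

end

theory Submission
  imports Defs
begin

text \<open>Fix a chart around each \<open>p v\<close>. Tangent vectors at \<open>p\<close> then correspond to vectors of
  \<open>E\<^sup>V\<close>, of dimension \<open>dim E \<cdot> |V|\<close>, and by the chain rule the flexes of \<open>(G, p)\<close> correspond to the
  common kernel of the differentials of the edge separations in these charts alone. A flex of
  \<open>(K(V), p)\<close> is a flex of \<open>(G, p)\<close>, so by infinitesimal rigidity both flex spaces agree. Minimality
  provides, for every edge \<open>e\<close>, a velocity vector killed by all edge differentials except the one
  of \<open>e\<close>; hence each edge lowers the dimension of the kernel by exactly one.\<close>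

section \<open>Linear algebra\<close>

lemma subspace_power:
  assumes "subspace E"
  shows "subspace {a :: 'e::euclidean_space ^ 'v. \<forall>v. a $ v \<in> E}"
  using assms by (auto simp: subspace_def)

text \<open>Induction over the set \<open>S\<close> of coordinates that may be nonzero: each further
  coordinate adds a direct summand, the copy of \<open>E\<close> embedded by
  \<open>axis v\<close>.\<close>

lemma dim_power:
  fixes E :: "'e::euclidean_space set"
  assumes "subspace E"
  shows "dim {a :: 'e ^ 'v::finite. \<forall>v. a $ v \<in> E} = dim E * CARD('v)"
proof -
  define P where "P S = {a :: 'e ^ 'v. \<forall>v. a $ v \<in> (if v \<in> S then E else {0})}" for S
  have subP: "subspace (P S)" for S
    using assms by (auto simp: P_def subspace_def split: if_splits)
  have "dim (P S) = dim E * card S" if "finite S" for S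
    using that
  proof induction
    case empty
    have "P {} = {0}"
      by (auto simp: P_def vec_eq_iff)
    then show ?case
      by simp
  next
    case (insert v S)
    let ?Q = "(axis v :: 'e \<Rightarrow> 'e ^ 'v) ` E"
    have lin: "linear (axis v :: 'e \<Rightarrow> 'e ^ 'v)"
      by (intro linearI) (auto simp: axis_def vec_eq_iff)
    have "{x + y |x y. x \<in> P S \<and> y \<in> ?Q} = P (insert v S)"
    proof (intro equalityI subsetI)
      fix a assume "a \<in> {x + y |x y. x \<in> P S \<and> y \<in> ?Q}"
      then show "a \<in> P (insert v S)"
        using insert.hyps assms
        by (auto simp: P_def axis_def subspace_add subspace_0 split: if_splits)
    next
      fix a assume a: "a \<in> P (insert v S)"
      have "a = (a - axis v (a $ v)) + axis v (a $ v)"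
        by simp
      moreover have "a - axis v (a $ v) \<in> P S"
        using a insert.hyps by (auto simp: P_def axis_def split: if_splits)
      moreover have "a $ v \<in> E"
        using a by (auto simp: P_def dest: spec[of _ v])
      then have "axis v (a $ v) \<in> ?Q"
        by (rule imageI)
      ultimately show "a \<in> {x + y |x y. x \<in> P S \<and> y \<in> ?Q}"
        by blast
    qed
    moreover have "P S \<inter> ?Q = {0}"
    proof -
      have "0 \<in> ?Q"
        using lin assms by (metis image_eqI linear_0 subspace_0)
      then show ?thesis
        using subspace_0[OF subP] insert.hyps
        by (auto simp: P_def axis_def vec_eq_iff split: if_splits)
    qed
    moreover have "dim ?Q = dim E"
      using lin by (intro dim_image_eq) (auto simp: inj_on_def axis_eq_axis)
    moreover have "subspace ?Q"
      using lin assms by (rule linear_subspace_image)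
    ultimately have "dim (P (insert v S)) = dim (P S) + dim E"
      using dim_sums_Int[OF subP, of ?Q S] by simp
    then show ?case
      using insert by simp
  qed
  from this[of UNIV] show ?thesis
    by (simp add: P_def)
qed

text \<open>The witnesses make the functionals linearly independent on \<open>V\<close>, so each of
  them cuts the dimension by exactly one. In the induction, the witness for the new functional lies
  in the common kernel of the others, and that kernel is the sum of the smaller one and the line
  through the witness.\<close>

lemma dim_common_kernel:
  fixes l :: "'i \<Rightarrow> 'b::euclidean_space \<Rightarrow> real"
  assumes "finite F" and "subspace V"
    and "\<And>i. i \<in> F \<Longrightarrow> linear (l i)"
    and "\<And>i. i \<in> F \<Longrightarrow> \<exists>u\<in>V. l i u \<noteq> 0 \<and> (\<forall>j\<in>F - {i}. l j u = 0)"
  shows "dim {a \<in> V. \<forall>i\<in>F. l i a = 0} + card F = dim V"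
  using assms(1,3,4)
proof (induction F)
  case empty
  then show ?case
    by simp
next
  case (insert e F)
  let ?K = "\<lambda>F. {a \<in> V. \<forall>i\<in>F. l i a = 0}"
  have sub: "subspace (?K H)" if "H \<subseteq> insert e F" for H
    using assms(2) insert.prems(1) that unfolding subspace_def
    by (auto simp: linear_0 linear_add linear_scale subset_iff)
  obtain u where u: "u \<in> V" "l e u \<noteq> 0" "\<forall>j\<in>F. l j u = 0"
    using insert.prems(2)[of e] insert.hyps by auto
  have lin: "linear (l e)"
    using insert.prems(1) by blast
  have "?K F \<subseteq> span (insert u (?K (insert e F)))"
  proof
    fix a assume a: "a \<in> ?K F"
    \<comment> \<open>The factor is chosen such that \<open>l e\<close> vanishes at
      \<open>a - ?r *\<^sub>R u\<close>.\<close>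
    let ?r = "l e a / l e u"
    have "a - ?r *\<^sub>R u \<in> ?K F"
      using a u by (intro subspace_diff[OF sub] subspace_scale[OF sub]) auto
    moreover have "l e (a - ?r *\<^sub>R u) = 0"
      using lin u by (simp add: linear_diff linear_scale)
    ultimately have "a - ?r *\<^sub>R u \<in> ?K (insert e F)"
      by simp
    then show "a \<in> span (insert u (?K (insert e F)))"
      by (meson span_base span_breakdown_eq)
  qed
  moreover have "insert u (?K (insert e F)) \<subseteq> ?K F"
    using u by auto
  ultimately have "dim (?K F) = dim (insert u (?K (insert e F)))"
    using dim_subset[of "?K F" "span (insert u (?K (insert e F)))"]
      dim_subset[of "insert u (?K (insert e F))" "?K F"] by (simp add: dim_span)
  \<comment> \<open>This kernel is a subspace, hence its own span, and \<open>l e\<close> vanishes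
    on it but not at \<open>u\<close>.\<close>
  moreover have "u \<notin> span (?K (insert e F))"
    using u sub[of "insert e F"] by (subst span_eq_iff[THEN iffD2]) auto
  ultimately have "dim (?K F) = dim (?K (insert e F)) + 1"
    by (simp add: dim_insert)
  moreover have "dim (?K F) + card F = dim V"
  proof (rule insert.IH)
    fix i assume i: "i \<in> F"
    then show "linear (l i)"
      using insert.prems(1) by blast
    show "\<exists>u\<in>V. l i u \<noteq> 0 \<and> (\<forall>j\<in>F - {i}. l j u = 0)"
      using insert.prems(2)[of i] i by blast
  qed
  ultimately show ?case
    using insert.hyps by simp
qed


section \<open>Derivatives within relatively open subsets of a subspace\<close>

text \<open>If \<open>V\<close> is a proper subspace, a derivative within a subset of
  \<open>V\<close> is not unique as a linear map on the whole space; it is determined in the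
  directions of \<open>V\<close> only. For such a direction, restriction to a line through
  \<open>x\<close> reduces the claim to uniqueness of derivatives in one real variable. Allowing two
  sets \<open>S\<close> and \<open>T\<close> makes it possible to compare coordinate expressions
  that have different domains.\<close>

lemma has_derivative_eq_on_subspace:
  fixes f g :: "'b::real_normed_vector \<Rightarrow> 'c::real_normed_vector"
  assumes f: "(f has_derivative f') (at x within S)"
    and g: "(g has_derivative g') (at x within T)"
    and V: "subspace V" and W: "openin (top_of_set V) W" "x \<in> W" "W \<subseteq> S" "W \<subseteq> T"
    and eq: "\<And>y. y \<in> W \<Longrightarrow> f y = g y"
    and v: "v \<in> V"
  shows "f' v = g' v"
proof -
  obtain e where e: "e > 0" "ball x e \<inter> V \<subseteq> W" and xV: "x \<in> V"
    using W(1,2) unfolding openin_contains_ball by blast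
  \<comment> \<open>For parameters below this bound the line stays in the ball of radius
    \<open>e\<close>; the summand 1 covers the direction \<open>v = 0\<close>.\<close>
  define \<delta> where "\<delta> = e / (norm v + 1)"
  have \<delta>: "\<delta> > 0"
    using e by (simp add: \<delta>_def add_nonneg_pos)
  define \<gamma> where "\<gamma> t = x + t *\<^sub>R v" for t :: real
  have \<gamma>W: "\<gamma> t \<in> W" if "t \<in> ball 0 \<delta>" for t
  proof -
    have "\<bar>t\<bar> * norm v \<le> \<bar>t\<bar> * (norm v + 1)"
      by (simp add: mult_left_mono)
    also have "\<dots> < e"
      using that by (simp add: \<delta>_def pos_less_divide_eq add_nonneg_pos)
    finally have "\<gamma> t \<in> ball x e"
      by (simp add: \<gamma>_def dist_norm)
    moreover have "\<gamma> t \<in> V"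
      using V v xV by (simp add: \<gamma>_def subspace_add subspace_scale)
    ultimately show ?thesis
      using e by blast
  qed
  have \<gamma>: "(\<gamma> has_derivative (\<lambda>t. t *\<^sub>R v)) (at 0 within ball 0 \<delta>)"
    unfolding \<gamma>_def by (auto intro!: derivative_eq_intros)
  have f0: "(f has_derivative f') (at (\<gamma> 0) within \<gamma> ` ball 0 \<delta>)"
    and g0: "(g has_derivative g') (at (\<gamma> 0) within \<gamma> ` ball 0 \<delta>)"
    using \<gamma>W W by (auto simp: \<gamma>_def intro!: has_derivative_subset[OF f] has_derivative_subset[OF g])
  have 0: "(0::real) \<in> ball 0 \<delta>"
    using \<delta> by simp
  have "(f \<circ> \<gamma> has_derivative f' \<circ> (\<lambda>t. t *\<^sub>R v)) (at 0)"
    using diff_chain_within[OF \<gamma> f0] at_within_open[OF 0] by simp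
  moreover have "(f \<circ> \<gamma> has_derivative g' \<circ> (\<lambda>t. t *\<^sub>R v)) (at 0)"
  proof (rule has_derivative_transform_within_open)
    show "(g \<circ> \<gamma> has_derivative g' \<circ> (\<lambda>t. t *\<^sub>R v)) (at 0)"
      using diff_chain_within[OF \<gamma> g0] at_within_open[OF 0] by simp
    show "open (ball (0::real) \<delta>)"
      by (rule open_ball)
    show "(g \<circ> \<gamma>) t = (f \<circ> \<gamma>) t" if "t \<in> ball 0 \<delta>" for t
      using eq[OF \<gamma>W[OF that]] by simp
  qed (rule 0)
  ultimately have "f' \<circ> (\<lambda>t. t *\<^sub>R v) = g' \<circ> (\<lambda>t. t *\<^sub>R v)"
    by (rule has_derivative_unique)
  from fun_cong[OF this, of 1] show ?thesis
    by simp
qed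

text \<open>The values of \<open>f\<close> stay in \<open>V\<close>, so pairing \<open>f\<close> with a vector orthogonal to \<open>V\<close> gives a
  function that vanishes identically.\<close>

lemma has_derivative_in_subspace:
  fixes f :: "'b::real_normed_vector \<Rightarrow> 'e::euclidean_space"
  assumes f: "(f has_derivative f') (at x within W)"
    and U: "subspace U" and W: "openin (top_of_set U) W" "x \<in> W"
    and V: "subspace V" "\<And>y. y \<in> W \<Longrightarrow> f y \<in> V" and u: "u \<in> U"
  shows "f' u \<in> V"
proof -
  have "z \<bullet> f' u = 0" if "z \<in> V\<^sup>\<bottom>" for z
  proof (rule has_derivative_eq_on_subspace[OF _ has_derivative_const U W])
    show "((\<lambda>y. z \<bullet> f y) has_derivative (\<lambda>h. z \<bullet> f' h)) (at x within W)"
      by (rule has_derivative_inner_right[OF f])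
    show "z \<bullet> f y = 0" if "y \<in> W" for y
      using V(2)[OF that] \<open>z \<in> V\<^sup>\<bottom>\<close>
      by (auto simp: orthogonal_comp_def orthogonal_def inner_commute)
  qed (use u in auto)
  then have "f' u \<in> V\<^sup>\<bottom>\<^sup>\<bottom>"
    by (auto simp: orthogonal_comp_def orthogonal_def)
  then show ?thesis
    using V by (simp add: orthogonal_comp_self)
qed

section \<open>Open boxes and componentwise derivatives in powers\<close>

lemma openin_power:
  fixes U :: "'v::finite \<Rightarrow> 'e::euclidean_space set"
  assumes "\<And>v. openin (top_of_set E) (U v)"
  shows "openin (top_of_set {a :: 'e ^ 'v. \<forall>v. a $ v \<in> E}) {a. \<forall>v. a $ v \<in> U v}"
proof -
  have "\<exists>T. open T \<and> U v = E \<inter> T" for v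
    using assms[of v] by (auto simp: openin_open)
  then obtain T where T: "\<And>v. open (T v)" "\<And>v. U v = E \<inter> T v"
    by metis
  have "open {a :: 'e ^ 'v. \<forall>v. a $ v \<in> T v}"
    using T by (intro open_vector_box) auto
  moreover have "{a :: 'e ^ 'v. \<forall>v. a $ v \<in> U v} = {a. \<forall>v. a $ v \<in> E} \<inter> {a. \<forall>v. a $ v \<in> T v}"
    using T by auto
  ultimately show ?thesis
    by (auto simp: openin_open)
qed

lemma has_derivative_vec_lambda:
  fixes f :: "'v::finite \<Rightarrow> 'b::real_normed_vector \<Rightarrow> 'e::euclidean_space"
  assumes "\<And>v. (f v has_derivative f' v) (at x within S)"
  shows "((\<lambda>y. \<chi> v. f v y) has_derivative (\<lambda>h. \<chi> v. f' v h)) (at x within S)"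
proof -
  have ax: "bounded_linear (axis v :: 'e \<Rightarrow> 'e ^ 'v)" for v
    unfolding linear_conv_bounded_linear[symmetric]
    by (intro linearI) (auto simp: axis_def vec_eq_iff)
  have sum: "(\<chi> v. h v) = (\<Sum>v\<in>UNIV. axis v (h v))" for h :: "'v \<Rightarrow> 'e"
    by (auto simp: vec_eq_iff axis_def if_distrib cong: if_cong)
  show ?thesis
    unfolding sum by (intro has_derivative_sum bounded_linear.has_derivative[OF ax] assms)
qed

lemma has_derivative_vec_nth:
  "(f has_derivative f') (at x within S) \<Longrightarrow>
    ((\<lambda>y. f y $ i) has_derivative (\<lambda>h. f' h $ i)) (at x within S)"
  by (rule bounded_linear.has_derivative[OF bounded_linear_vec_nth])


section \<open>Tangent spaces in coordinates\<close>

context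
  fixes M :: "'a::topological_space set" and E :: "'e::euclidean_space set"
    and A :: "('a, 'e) chart set"
  assumes manifold: "smooth_manifold M E A"
begin

lemma subspace_model: "subspace E"
  using manifold by (simp add: smooth_manifold_def)

lemma chart_exists: "x \<in> M \<Longrightarrow> \<exists>\<kappa>. \<kappa> \<in> charts_at A x"
  using manifold by (auto simp: smooth_manifold_def charts_at_def)

lemma openin_chart_image: "\<kappa> \<in> A \<Longrightarrow> openin (top_of_set E) (chart_image \<kappa>)"
  using manifold by (auto simp: smooth_manifold_def)

lemma chart_homeomorphism:
  "\<kappa> \<in> A \<Longrightarrow> homeomorphism (fst \<kappa>) (chart_image \<kappa>) (snd \<kappa>) (chart_inv \<kappa>)"
  using manifold by (auto simp: smooth_manifold_def)

lemma chart_inv_chart: "\<kappa> \<in> A \<Longrightarrow> x \<in> fst \<kappa> \<Longrightarrow> chart_inv \<kappa> (snd \<kappa> x) = x"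
  using chart_homeomorphism by (auto simp: homeomorphism_def)

text \<open>Finitely many chart domains intersect in an open subset of the domain of \<kappa>, which
  the chart maps homeomorphically to an open subset of its image, and that image is open in
  \<open>E\<close>. One chart in \<open>B\<close> gives the overlaps, two give the triple overlaps
  on which transition maps are composed.\<close>

lemma openin_chart_Int:
  assumes "\<kappa> \<in> A" "\<And>\<mu>. \<mu> \<in> B \<Longrightarrow> \<mu> \<in> A" "finite B"
  shows "openin (top_of_set E) (snd \<kappa> ` (fst \<kappa> \<inter> (\<Inter>\<mu>\<in>B. fst \<mu>)))"
proof -
  have o: "openin (top_of_set M) (fst \<mu>)" if "\<mu> \<in> A" for \<mu>
    using manifold that by (auto simp: smooth_manifold_def)
  have "openin (top_of_set M) (fst \<kappa> \<inter> (\<Inter>\<mu>\<in>B. fst \<mu>))"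
    using assms(3,2)
  proof induction
    case empty
    then show ?case
      using o[OF assms(1)] by simp
  next
    case (insert \<mu> B)
    have "openin (top_of_set M) (fst \<mu> \<inter> (fst \<kappa> \<inter> (\<Inter>\<mu>\<in>B. fst \<mu>)))"
    proof (rule openin_Int)
      show "openin (top_of_set M) (fst \<mu>)"
        using insert.prems by (intro o) simp
      show "openin (top_of_set M) (fst \<kappa> \<inter> (\<Inter>\<mu>\<in>B. fst \<mu>))"
        using insert.prems by (intro insert.IH) simp
    qed
    then show ?case
      by (simp add: Int_left_commute)
  qed
  then have "openin (top_of_set (fst \<kappa>)) (fst \<kappa> \<inter> (\<Inter>\<mu>\<in>B. fst \<mu>))"
    by (rule openin_subset_trans) (use o[OF assms(1)] openin_imp_subset in auto)
  then have "openin (top_of_set (chart_image \<kappa>)) (snd \<kappa> ` (fst \<kappa> \<inter> (\<Inter>\<mu>\<in>B. fst \<mu>)))"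
    using homeomorphism_imp_open_map[OF chart_homeomorphism[OF assms(1)]] by blast
  then show ?thesis
    using openin_chart_image[OF assms(1)] openin_trans by blast
qed

section \<open>Transition maps and their derivatives\<close>

lemma openin_overlap: "\<kappa> \<in> A \<Longrightarrow> \<mu> \<in> A \<Longrightarrow> openin (top_of_set E) (overlap \<kappa> \<mu>)"
  using openin_chart_Int[of \<kappa> "{\<mu>}"] by (simp add: overlap_def)

lemma overlap_subset: "overlap \<kappa> \<mu> \<subseteq> chart_image \<kappa>"
  by (auto simp: overlap_def chart_image_def)

lemma transition_chart: "\<kappa> \<in> A \<Longrightarrow> x \<in> fst \<kappa> \<Longrightarrow> transition \<kappa> \<mu> (snd \<kappa> x) = snd \<mu> x"
  by (simp add: transition_def chart_inv_chart)

lemma transition_in_chart_image: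
  "\<kappa> \<in> A \<Longrightarrow> a \<in> overlap \<kappa> \<mu> \<Longrightarrow> transition \<kappa> \<mu> a \<in> chart_image \<mu>"
  by (auto simp: overlap_def transition_chart chart_image_def)

lemma chart_inv_transition:
  "\<kappa> \<in> A \<Longrightarrow> \<mu> \<in> A \<Longrightarrow> a \<in> overlap \<kappa> \<mu> \<Longrightarrow>
    chart_inv \<mu> (transition \<kappa> \<mu> a) = chart_inv \<kappa> a"
  by (auto simp: overlap_def transition_chart chart_inv_chart)

abbreviation transition_deriv :: "'a \<Rightarrow> ('a, 'e) chart \<Rightarrow> ('a, 'e) chart \<Rightarrow> 'e \<Rightarrow> 'e" where
  "transition_deriv x \<kappa> \<mu> \<equiv>
     frechet_derivative (transition \<kappa> \<mu>) (at (snd \<kappa> x) within overlap \<kappa> \<mu>)"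

lemma chart_in_overlap:
  "\<kappa> \<in> charts_at A x \<Longrightarrow> \<mu> \<in> charts_at A x \<Longrightarrow> snd \<kappa> x \<in> overlap \<kappa> \<mu>"
  by (auto simp: charts_at_def overlap_def)

lemma has_derivative_transition:
  assumes "\<kappa> \<in> charts_at A x" "\<mu> \<in> charts_at A x"
  shows "(transition \<kappa> \<mu> has_derivative transition_deriv x \<kappa> \<mu>)
           (at (snd \<kappa> x) within overlap \<kappa> \<mu>)"
proof -
  have "smooth_on E (overlap \<kappa> \<mu>) (transition \<kappa> \<mu>)"
    using manifold assms by (auto simp: smooth_manifold_def charts_at_def)
  then have "times_differentiable_on (Suc 0) E (overlap \<kappa> \<mu>) (transition \<kappa> \<mu>)"
    by (simp only: smooth_on_def)
  then show ?thesis
    using chart_in_overlap[OF assms]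
    by (simp add: differentiable_on_def frechet_derivative_works)
qed

text \<open>The transition map takes its values in a chart image, hence in \<open>E\<close>, and so
  do its derivatives in directions of \<open>E\<close>.\<close>

lemma transition_deriv_in_model:
  assumes "\<kappa> \<in> charts_at A x" "\<mu> \<in> charts_at A x" "v \<in> E"
  shows "transition_deriv x \<kappa> \<mu> v \<in> E"
proof (rule has_derivative_in_subspace[OF has_derivative_transition[OF assms(1,2)] subspace_model
      openin_overlap chart_in_overlap[OF assms(1,2)] subspace_model _ assms(3)])
  fix a assume "a \<in> overlap \<kappa> \<mu>"
  then have "transition \<kappa> \<mu> a \<in> chart_image \<mu>"
    using assms by (intro transition_in_chart_image) (auto simp: charts_at_def)
  then show "transition \<kappa> \<mu> a \<in> E"
    using openin_chart_image[of \<mu>] assms openin_imp_subset by (auto simp: charts_at_def)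
qed (use assms in \<open>auto simp: charts_at_def\<close>)

text \<open>The transition map from a chart to itself is the identity on its domain. The restriction
  to \<open>E\<close> matters, since other directions leave the derivative undetermined.\<close>

lemma transition_deriv_refl:
  assumes "\<kappa> \<in> charts_at A x" "v \<in> E"
  shows "transition_deriv x \<kappa> \<kappa> v = v"
proof (rule has_derivative_eq_on_subspace[OF has_derivative_transition[OF assms(1,1)]
      has_derivative_ident subspace_model openin_overlap chart_in_overlap[OF assms(1,1)]
      _ _ _ assms(2)])
  show "transition \<kappa> \<kappa> a = a" if "a \<in> overlap \<kappa> \<kappa>" for a
    using that assms by (auto simp: overlap_def charts_at_def transition_chart)
qed (use assms in \<open>auto simp: charts_at_def\<close>)

text \<open>This is the cocycle rule. It follows from the chain rule on the triple overlap
  \<open>?W\<close>, the set on which the composed transition map is defined and agrees with the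
  direct one.\<close>

lemma transition_deriv_trans:
  assumes \<kappa>: "\<kappa> \<in> charts_at A x" and \<mu>: "\<mu> \<in> charts_at A x" and \<nu>: "\<nu> \<in> charts_at A x"
    and v: "v \<in> E"
  shows "transition_deriv x \<mu> \<nu> (transition_deriv x \<kappa> \<mu> v) = transition_deriv x \<kappa> \<nu> v"
proof -
  let ?W = "snd \<kappa> ` (fst \<kappa> \<inter> (\<Inter>\<mu>\<in>{\<mu>, \<nu>}. fst \<mu>))"
  have in_A: "\<kappa> \<in> A" "\<mu> \<in> A" "\<nu> \<in> A" and x: "x \<in> fst \<kappa>" "x \<in> fst \<mu>" "x \<in> fst \<nu>"
    using \<kappa> \<mu> \<nu> by (auto simp: charts_at_def)
  have W: "?W \<subseteq> overlap \<kappa> \<mu>" "?W \<subseteq> overlap \<kappa> \<nu>" "snd \<kappa> x \<in> ?W"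
    using x by (auto simp: overlap_def)
  have "(transition \<kappa> \<mu> has_derivative transition_deriv x \<kappa> \<mu>) (at (snd \<kappa> x) within ?W)"
    using has_derivative_subset[OF has_derivative_transition[OF \<kappa> \<mu>] W(1)] .
  moreover have "(transition \<mu> \<nu> has_derivative transition_deriv x \<mu> \<nu>)
      (at (transition \<kappa> \<mu> (snd \<kappa> x)) within transition \<kappa> \<mu> ` ?W)"
    unfolding transition_chart[OF in_A(1) x(1)]
    by (rule has_derivative_subset[OF has_derivative_transition[OF \<mu> \<nu>]])
       (use in_A in \<open>auto simp: transition_chart overlap_def\<close>)
  ultimately have comp: "(transition \<mu> \<nu> \<circ> transition \<kappa> \<mu> has_derivative
      transition_deriv x \<mu> \<nu> \<circ> transition_deriv x \<kappa> \<mu>) (at (snd \<kappa> x) within ?W)"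
    by (rule diff_chain_within)
  have "(transition_deriv x \<mu> \<nu> \<circ> transition_deriv x \<kappa> \<mu>) v = transition_deriv x \<kappa> \<nu> v"
  proof (rule has_derivative_eq_on_subspace[OF comp has_derivative_transition[OF \<kappa> \<nu>]
        subspace_model openin_chart_Int W(3) subset_refl W(2) _ v])
    show "(transition \<mu> \<nu> \<circ> transition \<kappa> \<mu>) a = transition \<kappa> \<nu> a" if "a \<in> ?W" for a
      using that in_A by (auto simp: transition_chart)
  qed (use in_A in auto)
  then show ?thesis
    by simp
qed

lemma transition_deriv_tangent:
  assumes "\<xi> \<in> tangent_space E A x" "\<kappa> \<in> charts_at A x" "\<mu> \<in> charts_at A x"
  shows "transition_deriv x \<kappa> \<mu> (\<xi> \<kappa>) = \<xi> \<mu>"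
proof -
  have "\<forall>\<kappa>\<in>charts_at A x. \<forall>\<mu>\<in>charts_at A x. \<xi> \<mu> = transition_deriv x \<kappa> \<mu> (\<xi> \<kappa>)"
    using assms(1) unfolding tangent_space_def mem_Collect_eq by (elim conjE)
  from this[THEN bspec, OF assms(2), THEN bspec, OF assms(3)] show ?thesis
    by (rule sym)
qed

section \<open>Velocity vectors in a fixed family of charts\<close>

abbreviation model_power :: "('e ^ 'v::finite) set" where
  "model_power \<equiv> {a. \<forall>v. a $ v \<in> E}"

abbreviation coords :: "('v::finite \<Rightarrow> ('a, 'e) chart) \<Rightarrow> ('v \<Rightarrow> 'a) \<Rightarrow> 'e ^ 'v" where
  "coords c p \<equiv> \<chi> v. snd (c v) (p v)"

abbreviation velocity_coords ::
    "('v::finite \<Rightarrow> ('a, 'e) chart) \<Rightarrow> ('v \<Rightarrow> ('a, 'e) chart \<Rightarrow> 'e) \<Rightarrow> 'e ^ 'v" where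
  "velocity_coords c u \<equiv> \<chi> v. u v (c v)"

text \<open>The inverse of \<open>velocity_coords c\<close>: a coordinate vector in the chosen
  charts is carried to all other charts around the joints by the transition derivatives. The value 0
  elsewhere is the convention of \<open>tangent_space\<close>.\<close>

definition velocity ::
    "('v::finite \<Rightarrow> ('a, 'e) chart) \<Rightarrow> ('v \<Rightarrow> 'a) \<Rightarrow> 'e ^ 'v \<Rightarrow> 'v \<Rightarrow> ('a, 'e) chart \<Rightarrow> 'e" where
  "velocity c p a v \<kappa> =
     (if \<kappa> \<in> charts_at A (p v) then transition_deriv (p v) (c v) \<kappa> (a $ v) else 0)"

lemma linear_velocity:
  assumes "\<And>v. c v \<in> charts_at A (p v)"
  shows "linear (velocity c p)"
proof -
  have lin: "linear (transition_deriv (p v) (c v) \<kappa>)" if "\<kappa> \<in> charts_at A (p v)" for v \<kappa>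
    by (rule has_derivative_linear[OF has_derivative_transition[OF assms that]])
  show ?thesis
    by (intro linearI)
       (simp_all add: velocity_def fun_eq_iff plus_fun_def scaleR_fun_def
          linear_add[OF lin] linear_scale[OF lin])
qed

text \<open>Compatibility of the representatives in two charts is the cocycle rule, with the chosen
  chart \<open>c v\<close> as the starting point.\<close>

lemma velocity_in_power_tangent_space:
  assumes "\<And>v. c v \<in> charts_at A (p v)" "a \<in> model_power"
  shows "velocity c p a \<in> power_tangent_space E A p"
  using assms
  by (auto simp: power_tangent_space_def tangent_space_def velocity_def
      transition_deriv_in_model transition_deriv_trans)

lemma velocity_coords_velocity:
  assumes "\<And>v. c v \<in> charts_at A (p v)" "a \<in> model_power"
  shows "velocity_coords c (velocity c p a) = a"
  using assms by (auto simp: velocity_def vec_eq_iff transition_deriv_refl)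

lemma velocity_coords_in_model_power:
  assumes "\<And>v. c v \<in> charts_at A (p v)" "u \<in> power_tangent_space E A p"
  shows "velocity_coords c u \<in> model_power"
  using assms by (auto simp: power_tangent_space_def tangent_space_def)

lemma velocity_velocity_coords:
  assumes "\<And>v. c v \<in> charts_at A (p v)" "u \<in> power_tangent_space E A p"
  shows "velocity c p (velocity_coords c u) = u"
proof (intro ext)
  fix v \<kappa>
  have uv: "u v \<in> tangent_space E A (p v)"
    using assms(2) by (simp add: power_tangent_space_def)
  then have "u v \<kappa> = 0" if "\<kappa> \<notin> charts_at A (p v)"
    using that unfolding tangent_space_def by blast
  then show "velocity c p (velocity_coords c u) v \<kappa> = u v \<kappa>"
    using transition_deriv_tangent[OF uv assms(1)] by (simp add: velocity_def)
qed

text \<open>On the product \<open>?W\<close> of the overlaps, the change of coordinates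
  \<open>?\<tau>\<close> turns one coordinate expression of \<open>f\<close> into the other, so the
  chain rule gives \<open>D = D' o ?T\<close> in the directions of \<open>model_power\<close>; and
  \<open>?T\<close> maps the coordinates of a velocity vector in \<open>c\<close> to those in
  \<open>c'\<close>, by the definition of tangent vectors. For \<open>c' = c\<close> the lemma says
  that any two derivatives agree on velocity vectors.\<close>

lemma power_derivative_chart_independent:
  fixes f :: "('v::finite \<Rightarrow> 'a) \<Rightarrow> 'b::real_normed_vector"
  assumes c: "\<And>v. c v \<in> charts_at A (p v)" and c': "\<And>v. c' v \<in> charts_at A (p v)"
    and D: "((f \<circ> power_chart_inv c) has_derivative D) (at (coords c p) within power_chart_image c)"
    and D': "((f \<circ> power_chart_inv c') has_derivative D')
               (at (coords c' p) within power_chart_image c')"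
    and u: "u \<in> power_tangent_space E A p"
  shows "D (velocity_coords c u) = D' (velocity_coords c' u)"
proof -
  let ?W = "{a. \<forall>v. a $ v \<in> overlap (c v) (c' v)} :: ('e ^ 'v) set"
  let ?\<tau> = "\<lambda>a::'e^'v. \<chi> v. transition (c v) (c' v) (a $ v)"
  let ?T = "\<lambda>h::'e^'v. \<chi> v. transition_deriv (p v) (c v) (c' v) (h $ v)"
  have in_A: "c v \<in> A" "c' v \<in> A" and p: "p v \<in> fst (c v)" "p v \<in> fst (c' v)" for v
    using c[of v] c'[of v] by (auto simp: charts_at_def)
  have W: "openin (top_of_set model_power) ?W"
    by (intro openin_power openin_overlap in_A)
  have pW: "coords c p \<in> ?W"
    using c c' by (simp add: chart_in_overlap)
  have \<tau>: "(?\<tau> has_derivative ?T) (at (coords c p) within ?W)"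
  proof (rule has_derivative_vec_lambda)
    fix v
    have nth: "((\<lambda>a::'e^'v. a $ v) has_derivative (\<lambda>h. h $ v)) (at (coords c p) within ?W)"
      by (rule has_derivative_vec_nth[OF has_derivative_ident])
    have "(transition (c v) (c' v) has_derivative transition_deriv (p v) (c v) (c' v))
        (at (coords c p $ v) within (\<lambda>a. a $ v) ` ?W)"
      using has_derivative_subset[OF has_derivative_transition[OF c[of v] c'[of v]],
          of "(\<lambda>a. a $ v) ` ?W"] by auto
    from diff_chain_within[OF nth this]
    show "((\<lambda>a. transition (c v) (c' v) (a $ v)) has_derivative
        (\<lambda>h. transition_deriv (p v) (c v) (c' v) (h $ v))) (at (coords c p) within ?W)"
      by (simp add: o_def)
  qed
  have "?\<tau> (coords c p) = coords c' p"
    by (simp add: transition_chart in_A p)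
  moreover have "?\<tau> ` ?W \<subseteq> power_chart_image c'"
    by (auto simp: power_chart_image_def transition_in_chart_image in_A)
  ultimately have "((f \<circ> power_chart_inv c') has_derivative D')
      (at (?\<tau> (coords c p)) within ?\<tau> ` ?W)"
    using has_derivative_subset[OF D'] by simp
  from diff_chain_within[OF \<tau> this]
  have comp: "((f \<circ> power_chart_inv c') \<circ> ?\<tau> has_derivative D' \<circ> ?T)
      (at (coords c p) within ?W)" .
  have "D (velocity_coords c u) = (D' \<circ> ?T) (velocity_coords c u)"
  proof (rule has_derivative_eq_on_subspace[OF D comp subspace_power[OF subspace_model] W pW])
    show "?W \<subseteq> power_chart_image c"
      unfolding power_chart_image_def
      by (blast intro: subsetD[OF overlap_subset])
    show "(f \<circ> power_chart_inv c) a = ((f \<circ> power_chart_inv c') \<circ> ?\<tau>) a" if "a \<in> ?W" for a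
      using that by (simp add: power_chart_inv_def chart_inv_transition in_A)
    show "velocity_coords c u \<in> model_power"
      using velocity_coords_in_model_power[OF c u] .
  qed auto
  moreover have "?T (velocity_coords c u) = velocity_coords c' u"
    using u c c' by (simp add: vec_eq_iff power_tangent_space_def transition_deriv_tangent)
  ultimately show ?thesis
    by simp
qed


section \<open>Infinitesimal flexes in coordinates\<close>

context
  fixes d\<^sub>1 d\<^sub>2 :: "'a \<Rightarrow> 'a \<Rightarrow> real"
  assumes sep: "separation_distance d\<^sub>1" "separation_distance d\<^sub>2"
    and diff: "differentiable_separation M A d\<^sub>1" "differentiable_separation M A d\<^sub>2"
begin

text \<open>The two cases match the two clauses of \<open>differentiable_separation\<close>. A loop
  evaluates the separation distance along the diagonal; any other edge evaluates it near a pair of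
  distinct points, because a framework has distinct joints at adjacent vertices.\<close>

lemma edge_sep_differentiable:
  fixes p :: "'v::finite \<Rightarrow> 'a"
  assumes fr: "framework M G p" and e: "e \<in> G" and c: "\<And>v. c v \<in> charts_at A (p v)"
  shows "(edge_sep d\<^sub>1 d\<^sub>2 e \<circ> power_chart_inv c) differentiable
           (at (coords c p) within power_chart_image c)"
proof -
  obtain v w i where e_eq: "e = (Upair v w, i)"
    by (metis surj_pair uprod_exhaust)
  define d where "d = colour_sep d\<^sub>1 d\<^sub>2 i"
  have d: "differentiable_separation M A d"
    unfolding d_def using diff by (cases i) auto
  have sep_eq: "edge_sep d\<^sub>1 d\<^sub>2 e \<circ> power_chart_inv c =
      (\<lambda>a. d (chart_inv (c v) (a $ v)) (chart_inv (c w) (a $ w)))"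
    by (simp add: fun_eq_iff e_eq edge_sep_Upair[OF sep] d_def power_chart_inv_def)
  have pM: "p v \<in> M" "p w \<in> M"
    using fr by (auto simp: framework_def)
  have nth: "(\<lambda>a::'e^'v. a $ v) differentiable F" for v F
    by (intro bounded_linear_imp_differentiable bounded_linear_vec_nth)
  show ?thesis
  proof (cases "v = w")
    case True
    have "(\<lambda>a. d (chart_inv (c v) a) (chart_inv (c v) a)) differentiable
        (at (snd (c v) (p v)) within chart_image (c v))"
      using d c[of v] pM
      by (simp add: differentiable_separation_def self_sep_differentiable_at_def)
    then have "(\<lambda>a. d (chart_inv (c v) a) (chart_inv (c v) a)) differentiable
        (at (coords c p $ v) within (\<lambda>a. a $ v) ` power_chart_image c)"
      \<comment> \<open>Besides shrinking the set, \<open>back_subst\<close> rewrites the base point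
        as a coordinate of \<open>coords c p\<close>, the form in which the chain rule along the
        projection expects it.\<close>
      by (rule differentiable_within_subset[THEN back_subst[of "\<lambda>x. _ differentiable x"]])
         (auto simp: power_chart_image_def)
    from differentiable_chain_within[OF nth this] show ?thesis
      unfolding sep_eq True[symmetric] by (simp add: o_def)
  next
    case False
    then have "p v \<noteq> p w"
      using fr e e_eq by (auto simp: framework_def)
    then have "sep_in_charts d (c v) (c w) differentiable
        (at (snd (c v) (p v), snd (c w) (p w)) within chart_image (c v) \<times> chart_image (c w))"
      using d c[of v] c[of w] pM
      by (simp add: differentiable_separation_def sep_differentiable_at_def)
    then have "sep_in_charts d (c v) (c w) differentiable
        (at (snd (c v) (p v), snd (c w) (p w)) within
          (\<lambda>a. (a $ v, a $ w)) ` power_chart_image c)"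
      by (rule differentiable_within_subset) (auto simp: power_chart_image_def)
    moreover have "(\<lambda>a::'e^'v. (a $ v, a $ w)) differentiable
        (at (coords c p) within power_chart_image c)"
      by (intro bounded_linear_imp_differentiable bounded_linear_Pair bounded_linear_vec_nth)
    ultimately have "(sep_in_charts d (c v) (c w) \<circ> (\<lambda>a. (a $ v, a $ w))) differentiable
        (at (coords c p) within power_chart_image c)"
      by (intro differentiable_chain_within) auto
    then show ?thesis
      unfolding sep_eq by (simp add: sep_in_charts_def o_def)
  qed
qed

text \<open>The row of the rigidity matrix that belongs to \<open>e\<close>, in the coordinates
  given by \<open>c\<close>.\<close>

definition edge_deriv ::
    "('v::finite \<Rightarrow> ('a, 'e) chart) \<Rightarrow> ('v \<Rightarrow> 'a) \<Rightarrow> 'v edge \<Rightarrow> 'e ^ 'v \<Rightarrow> real" where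
  "edge_deriv c p e = frechet_derivative (edge_sep d\<^sub>1 d\<^sub>2 e \<circ> power_chart_inv c)
     (at (coords c p) within power_chart_image c)"

lemma has_derivative_edge_sep:
  assumes "framework M G p" "e \<in> G" "\<And>v. c v \<in> charts_at A (p v)"
  shows "((edge_sep d\<^sub>1 d\<^sub>2 e \<circ> power_chart_inv c) has_derivative edge_deriv c p e)
           (at (coords c p) within power_chart_image c)"
  unfolding edge_deriv_def frechet_derivative_works[symmetric]
  using assms by (rule edge_sep_differentiable)

text \<open>A derivative of the rigidity map of \<open>H\<close> is projected to the coordinates in
  \<open>G\<close>. The argument starts from an existing derivative instead of the edge
  differentials because \<open>H\<close> will be the complete graph: \<open>p\<close> may identify
  vertices that are adjacent there, and then some edge separations may fail to be
  differentiable.\<close>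

lemma inf_flex_space_antimono:
  fixes p :: "'v::finite \<Rightarrow> 'a"
  assumes "G \<subseteq> H"
  shows "inf_flex_space E A d\<^sub>1 d\<^sub>2 H p \<subseteq> inf_flex_space E A d\<^sub>1 d\<^sub>2 G p"
proof -
  have "\<exists>D. ((rigidity_map d\<^sub>1 d\<^sub>2 G \<circ> power_chart_inv c) has_derivative D) (at x within S) \<and> D h = 0"
    if D: "((rigidity_map d\<^sub>1 d\<^sub>2 H \<circ> power_chart_inv c) has_derivative D) (at x within S)"
      and h: "D h = 0" for c :: "'v \<Rightarrow> ('a, 'e) chart" and x S D h
  proof (intro exI conjI)
    show "(\<chi> e. if e \<in> G then D h $ e else 0) = 0"
      using h by (simp add: vec_eq_iff)
    have "((\<lambda>a. \<chi> e. if e \<in> G then (rigidity_map d\<^sub>1 d\<^sub>2 H \<circ> power_chart_inv c) a $ e else 0)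
        has_derivative (\<lambda>h. \<chi> e. if e \<in> G then D h $ e else 0)) (at x within S)"
    proof (rule has_derivative_vec_lambda)
      fix e
      show "((\<lambda>a. if e \<in> G then (rigidity_map d\<^sub>1 d\<^sub>2 H \<circ> power_chart_inv c) a $ e else 0)
        has_derivative (\<lambda>h. if e \<in> G then D h $ e else 0)) (at x within S)"
        using has_derivative_vec_nth[OF D, of e] by (cases "e \<in> G") auto
    qed
    moreover have "(\<lambda>a. \<chi> e. if e \<in> G then (rigidity_map d\<^sub>1 d\<^sub>2 H \<circ> power_chart_inv c) a $ e else 0)
        = rigidity_map d\<^sub>1 d\<^sub>2 G \<circ> power_chart_inv c"
      using assms by (auto simp: rigidity_map_def fun_eq_iff vec_eq_iff)
    ultimately show "((rigidity_map d\<^sub>1 d\<^sub>2 G \<circ> power_chart_inv c) has_derivative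
        (\<lambda>h. \<chi> e. if e \<in> G then D h $ e else 0)) (at x within S)"
      by simp
  qed
  then show ?thesis
    unfolding inf_flex_space_def has_differential_value_def by blast
qed

text \<open>The definition of a flex quantifies over all families of charts and over unspecified
  derivatives. Chart independence reduces this to the family \<open>c\<close> and the functionals
  \<open>edge_deriv c p e\<close>, the components of one such derivative.\<close>

lemma inf_flex_iff:
  assumes fr: "framework M G p" and c: "\<And>v. c v \<in> charts_at A (p v)"
  shows "u \<in> inf_flex_space E A d\<^sub>1 d\<^sub>2 G p \<longleftrightarrow>
    u \<in> power_tangent_space E A p \<and> (\<forall>e\<in>G. edge_deriv c p e (velocity_coords c u) = 0)"
proof (intro iffI conjI ballI)
  assume u: "u \<in> inf_flex_space E A d\<^sub>1 d\<^sub>2 G p"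
  then show ut: "u \<in> power_tangent_space E A p"
    by (simp add: inf_flex_space_def)
  fix e assume e: "e \<in> G"
  obtain D where D: "((rigidity_map d\<^sub>1 d\<^sub>2 G \<circ> power_chart_inv c) has_derivative D)
      (at (coords c p) within power_chart_image c)" "D (velocity_coords c u) = 0"
    using u c by (auto simp: inf_flex_space_def has_differential_value_def)
  have "((edge_sep d\<^sub>1 d\<^sub>2 e \<circ> power_chart_inv c) has_derivative (\<lambda>h. D h $ e))
      (at (coords c p) within power_chart_image c)"
    using has_derivative_vec_nth[OF D(1), of e] e by (simp add: rigidity_map_def o_def)
  \<comment> \<open>Chart independence with \<open>c\<close> taken twice: the component of
    \<open>D\<close> and \<open>edge_deriv c p e\<close> may differ as linear maps, but not at the
    coordinates of a velocity vector.\<close>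
  from power_derivative_chart_independent[OF c c has_derivative_edge_sep[OF fr e c] this ut] D(2)
  show "edge_deriv c p e (velocity_coords c u) = 0"
    by simp
next
  assume "u \<in> power_tangent_space E A p \<and> (\<forall>e\<in>G. edge_deriv c p e (velocity_coords c u) = 0)"
  then have ut: "u \<in> power_tangent_space E A p"
    and u0: "\<And>e. e \<in> G \<Longrightarrow> edge_deriv c p e (velocity_coords c u) = 0"
    by auto
  have "has_differential_value A (rigidity_map d\<^sub>1 d\<^sub>2 G) p u 0"
    unfolding has_differential_value_def
  proof (intro allI impI exI conjI)
    fix c' assume "\<forall>v. c' v \<in> charts_at A (p v)"
    then have c': "\<And>v. c' v \<in> charts_at A (p v)"
      by blast
    let ?D = "\<lambda>h. \<chi> e. if e \<in> G then edge_deriv c' p e h else 0"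
    \<comment> \<open>The vanishing is carried over from the fixed charts \<open>c\<close> to the
      arbitrary charts \<open>c'\<close>.\<close>
    have "edge_deriv c' p e (velocity_coords c' u) = 0" if "e \<in> G" for e
      using power_derivative_chart_independent[OF c c' has_derivative_edge_sep[OF fr that c]
          has_derivative_edge_sep[OF fr that c'] ut] u0[OF that] by simp
    then show "?D (velocity_coords c' u) = 0"
      by (simp add: vec_eq_iff)
    have "((\<lambda>a. \<chi> e. if e \<in> G then (edge_sep d\<^sub>1 d\<^sub>2 e \<circ> power_chart_inv c') a else 0)
        has_derivative ?D) (at (coords c' p) within power_chart_image c')"
    proof (rule has_derivative_vec_lambda)
      fix e
      show "((\<lambda>a. if e \<in> G then (edge_sep d\<^sub>1 d\<^sub>2 e \<circ> power_chart_inv c') a else 0) has_derivative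
          (\<lambda>h. if e \<in> G then edge_deriv c' p e h else 0))
          (at (coords c' p) within power_chart_image c')"
        using has_derivative_edge_sep[OF fr _ c', of e] by (cases "e \<in> G") (auto simp: o_def)
    qed
    then show "((rigidity_map d\<^sub>1 d\<^sub>2 G \<circ> power_chart_inv c') has_derivative ?D)
        (at (coords c' p) within power_chart_image c')"
      by (simp add: rigidity_map_def o_def cong: if_cong)
  qed
  with ut show "u \<in> inf_flex_space E A d\<^sub>1 d\<^sub>2 G p"
    by (simp add: inf_flex_space_def)
qed

text \<open>This moves the flex space, a space of functions, to a kernel inside a Euclidean space,
  where dimensions can be counted.\<close>

lemma inf_flex_space_eq_image:
  assumes fr: "framework M G p" and c: "\<And>v. c v \<in> charts_at A (p v)"
  shows "inf_flex_space E A d\<^sub>1 d\<^sub>2 G p =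
    velocity c p ` {a \<in> model_power. \<forall>e\<in>G. edge_deriv c p e a = 0}"
proof (intro equalityI subsetI)
  fix u assume "u \<in> inf_flex_space E A d\<^sub>1 d\<^sub>2 G p"
  then have u: "u \<in> power_tangent_space E A p"
      "\<forall>e\<in>G. edge_deriv c p e (velocity_coords c u) = 0"
    using inf_flex_iff[OF fr c] by auto
  then have "velocity_coords c u \<in> {a \<in> model_power. \<forall>e\<in>G. edge_deriv c p e a = 0}"
    using velocity_coords_in_model_power[OF c u(1)] by blast
  then show "u \<in> velocity c p ` {a \<in> model_power. \<forall>e\<in>G. edge_deriv c p e a = 0}"
    using velocity_velocity_coords[OF c u(1)] by (metis (no_types, lifting) image_eqI)
next
  fix u assume "u \<in> velocity c p ` {a \<in> model_power. \<forall>e\<in>G. edge_deriv c p e a = 0}"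
  then obtain a where a: "a \<in> model_power" "\<forall>e\<in>G. edge_deriv c p e a = 0"
      and u: "u = velocity c p a"
    by blast
  then show "u \<in> inf_flex_space E A d\<^sub>1 d\<^sub>2 G p"
    unfolding inf_flex_iff[OF fr c] u
    by (simp only: velocity_in_power_tangent_space[OF c a(1)] velocity_coords_velocity[OF c a(1)])
qed

section \<open>The dimension count\<close>

lemma min_inf_rigid_dim:
  fixes p :: "'v::finite \<Rightarrow> 'a"
  assumes fr: "framework M G p" and min: "min_inf_rigid E A d\<^sub>1 d\<^sub>2 G p"
  shows "dim (inf_flex_space E A d\<^sub>1 d\<^sub>2 complete_edges p) + card G = dim E * CARD('v)"
proof -
  have "\<exists>\<kappa>. \<kappa> \<in> charts_at A (p v)" for v
    using fr chart_exists by (simp add: framework_def)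
  then obtain c where c: "\<And>v. c v \<in> charts_at A (p v)"
    by metis
  let ?K = "{a \<in> model_power. \<forall>e\<in>G. edge_deriv c p e a = 0}"
  \<comment> \<open>One inclusion is infinitesimal rigidity, the other holds because every edge of
    \<open>G\<close> is an edge of the complete graph. From here on the complete graph enters only
    through \<open>G\<close>, whose edge separations are differentiable at \<open>p\<close>.\<close>
  have flex_eq: "inf_flex_space E A d\<^sub>1 d\<^sub>2 complete_edges p = inf_flex_space E A d\<^sub>1 d\<^sub>2 G p"
    using min inf_flex_space_antimono[of G complete_edges p]
    by (auto simp: min_inf_rigid_def inf_rigid_def complete_edges_def)
  have "inj_on (velocity c p) model_power"
    by (rule inj_on_inverseI[of _ "velocity_coords c"]) (rule velocity_coords_velocity[OF c])
  \<comment> \<open>Equality of dimensions under a linear map is available for maps that are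
    injective on the span.\<close>
  moreover have "span ?K \<subseteq> model_power"
    by (intro span_minimal subspace_power subspace_model) auto
  ultimately have "inj_on (velocity c p) (span ?K)"
    by (rule inj_on_subset)
  then have "dim (inf_flex_space E A d\<^sub>1 d\<^sub>2 G p) = dim ?K"
    unfolding inf_flex_space_eq_image[OF fr c]
    by (intro dim_image_eq linear_velocity c)
  moreover have "dim ?K + card G = dim (model_power :: ('e ^ 'v) set)"
  proof (rule dim_common_kernel)
    show "finite G"
      by simp
    show "subspace (model_power :: ('e ^ 'v) set)"
      by (rule subspace_power[OF subspace_model])
    fix e assume e: "e \<in> G"
    show "linear (edge_deriv c p e)"
      by (rule has_derivative_linear[OF has_derivative_edge_sep[OF fr e c]])
    have fr': "framework M (G - {e}) p"
      using fr unfolding framework_def by blast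
    \<comment> \<open>Minimality gives a flex of \<open>G - {e}\<close> that is not a flex of the
      complete graph, hence by \<open>flex_eq\<close> not one of \<open>G\<close>. The two graphs
      differ in \<open>e\<close> alone, so the differential of \<open>e\<close> must be nonzero at
      \<open>u\<close>: its coordinates are the witness that \<open>dim_common_kernel\<close> asks
      for.\<close>
    obtain u where u: "u \<in> inf_flex_space E A d\<^sub>1 d\<^sub>2 (G - {e}) p"
        "u \<notin> inf_flex_space E A d\<^sub>1 d\<^sub>2 G p"
      using min e by (auto simp: min_inf_rigid_def flex_eq)
    then have "u \<in> power_tangent_space E A p"
        "\<forall>j\<in>G - {e}. edge_deriv c p j (velocity_coords c u) = 0"
        "edge_deriv c p e (velocity_coords c u) \<noteq> 0"
      unfolding inf_flex_iff[OF fr c] inf_flex_iff[OF fr' c] by auto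
    then show "\<exists>a\<in>model_power. edge_deriv c p e a \<noteq> 0 \<and> (\<forall>j\<in>G - {e}. edge_deriv c p j a = 0)"
      using velocity_coords_in_model_power[OF c, of u]
      by (intro bexI[of _ "velocity_coords c u"]) simp_all
  qed
  ultimately show ?thesis
    by (simp add: flex_eq dim_power[OF subspace_model])
qed

end

end

theorem theorem2p6:
  fixes X\<^sub>0 :: "'a::topological_space set"
    and E :: "'e::euclidean_space set"
    and A :: "('a, 'e) chart set"
    and d\<^sub>1 d\<^sub>2 :: "'a \<Rightarrow> 'a \<Rightarrow> real"
    and G :: "'v::finite edge set"
    and p :: "'v \<Rightarrow> 'a"
  assumes "ess_smooth_double_distance_context X\<^sub>0 E A d\<^sub>1 d\<^sub>2"
    and "connected X\<^sub>0"
    and "Metric_space X\<^sub>0 d\<^sub>1"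
    and "framework X\<^sub>0 G p"
    and "min_inf_rigid E A d\<^sub>1 d\<^sub>2 G p"
  shows "int (card G) =
    int (dim E) * int CARD('v) - int (dim (inf_flex_space E A d\<^sub>1 d\<^sub>2 complete_edges p))"
proof -
  have "smooth_manifold X\<^sub>0 E A" "separation_distance d\<^sub>1" "separation_distance d\<^sub>2"
    "differentiable_separation X\<^sub>0 A d\<^sub>1" "differentiable_separation X\<^sub>0 A d\<^sub>2"
    using assms(1) by (auto simp: ess_smooth_double_distance_context_def)
  then have "dim (inf_flex_space E A d\<^sub>1 d\<^sub>2 complete_edges p) + card G = dim E * CARD('v)"
    using assms(4,5) by (rule min_inf_rigid_dim)
  \<comment> \<open>The count is a sum of natural numbers; over the integers it can be solved for
    the number of edges without truncated subtraction.\<close>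
  from arg_cong[OF this, of int] show ?thesis
    by simp
qed

end
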